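(* There exists a constant $C>0$, depending only on the space dimension $d$, such that for every cell $K$, every edge $\sigma\in\mathcal{E}_K$, every positive discrete density $u$ and every discrete potential $\phi$, $$\mathrm{m}(\sigma)|\mathrm{D}_{K,\sigma}\sqrt u|\le C\Big(\mathcal{P}_{K,\sigma}[u,\phi]+\tau_\sigma|\mathrm{D}_{K,\sigma}\phi|^2+\mathrm{m}(\Delta_\sigma)(1+\overline u_\sigma)\Big),$$ where $\mathcal{P}_{K,\sigma}[u,\phi]=\mathcal{F}_{K,\sigma}[u,\phi]\,(\mathrm{D}_{K,\sigma}\log u+\mathrm{D}_{K,\sigma}\phi)$ and $\overline u_\sigma=\big(\tfrac12(u_K^{1/2}+u_{K,\sigma}^{1/2})\big)^2$.
   Context: $\mathcal{T}$ is an admissible finite-volume mesh (in the sense of Eymard--Gallouët--Herbin) of a bounded domain in $\mathbb{R}^d$, with cells $K$ and cell points $x_K$; for neighbours $K,L$ the segment $\overline{x_Kx_L}$ is orthogonal to the common edge $\sigma=K|L$; $\mathcal{E}_K$ is the set of edges (faces) of $K$. For a cellwise quantity $v=(v_K)_{K\in\mathcal{T}}$, together with given values $v_\sigma$ on exterior edges, $\mathrm{D}_{K,\sigma}v=v_{K,\sigma}-v_K$, where $v_{K,\sigma}=v_L$ if $\sigma=K|L$ and $v_{K,\sigma}=v_\sigma$ if $\sigma$ is exterior; $\mathrm{D}_{K,\sigma}f(v)=f(v_{K,\sigma})-f(v_K)$. A positive density has $u_K>0$ and $u_{K,\sigma}>0$. $\mathrm{m}$ denotes Lebesgue measure of the appropriate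 dimension; $\mathrm{d}_\sigma=d(x_K,x_L)$ if $\sigma=K|L$, $\mathrm{d}_\sigma=d(x_K,\sigma)$ if $\sigma$ is exterior; $\tau_\sigma=\mathrm{m}(\sigma)/\mathrm{d}_\sigma$. The dual cell $\Delta_\sigma$ is the interior of the convex hull of $\sigma\cup\{x_K,x_L\}$ (if $\sigma=K|L$) or $\sigma\cup\{x_K\}$ (if $\sigma$ is an exterior edge of $K$); it satisfies $d\,\mathrm{m}(\Delta_\sigma)=\mathrm{m}(\sigma)\mathrm{d}_\sigma$. $B(s)=s/(e^s-1)$ for $s\neq0$, $B(0)=1$; $\mathcal{F}_{K,\sigma}[u,\phi]=\tau_\sigma(B(-\mathrm{D}_{K,\sigma}\phi)u_{K,\sigma}-B(\mathrm{D}_{K,\sigma}\phi)u_K)$. *)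

theory Defs
  imports "HOL-Analysis.Analysis"
begin

section \<open>Lebesgue measure on hyperplanes\<close>

definition orthonormal_frame :: "'a::euclidean_space set \<Rightarrow> 'a \<Rightarrow> 'a set \<Rightarrow> bool" where
  "orthonormal_frame S p B \<longleftrightarrow>
     pairwise orthogonal B \<and> (\<forall>b\<in>B. norm b = 1) \<and> finite B \<and> card B = DIM('a) - 1 \<and>
     S \<subseteq> {p + v |v. v \<in> span B}"

text \<open>
  The \<open>(d-1)\<close>-dimensional Lebesgue measure of a subset of a hyperplane is the Lebesgue measure of
  the set of its Cartesian coordinates in the hyperplane. By invariance of Lebesgue measure under
  isometries it does not depend on the frame. It is meaningful only for sets contained in a
  hyperplane. In dimension 1 a hyperplane is a point and the value of a singleton is 1.
\<close>

definition face_measure :: "'a::euclidean_space set \<Rightarrow> real" where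
  "face_measure S =
     (let (p, B) = (SOME (p, B). orthonormal_frame S p B)
      in measure (completion (Pi\<^sub>M B (\<lambda>_. lborel)))
           {c \<in> B \<rightarrow>\<^sub>E UNIV. p + (\<Sum>b\<in>B. c b *\<^sub>R b) \<in> S})"


section \<open>Admissible finite-volume meshes\<close>

record 'a fv_mesh =
  cells :: "'a set set"
  edges :: "'a set set"
  edges_of :: "'a set \<Rightarrow> 'a set set"
  cell_point :: "'a set \<Rightarrow> 'a"

text \<open>\<open>common_edge M K L \<sigma>\<close> is the relation written \<open>\<sigma> = K|L\<close>.\<close>

definition common_edge ::
    "'a::euclidean_space fv_mesh \<Rightarrow> 'a set \<Rightarrow> 'a set \<Rightarrow> 'a set \<Rightarrow> bool" where
  "common_edge M K L \<sigma> \<longleftrightarrow>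
     K \<in> cells M \<and> L \<in> cells M \<and> K \<noteq> L \<and> \<sigma> \<in> edges M \<and> closure K \<inter> closure L = closure \<sigma>"

text \<open>
  This follows the definition of Eymard, Gallouet and Herbin. Two clauses make explicit what
  is tacit there. First, distinct cells are disjoint: if they overlap, the \<open>(d-1)\<close>-dimensional
  measure of the intersection of their closures is infinite. If they are disjoint, that
  intersection lies in a separating hyperplane, so \<open>face_measure\<close> is meaningful for it. Second,
  every edge of a cell is interior (some \<open>K|L\<close>) or exterior (part of the boundary of \<open>\<Omega>\<close>).
  Cell points do not lie on exterior edges: the transmissibility divides by the distance.
\<close>

definition admissible_mesh :: "'a::euclidean_space set \<Rightarrow> 'a fv_mesh \<Rightarrow> bool" where
  "admissible_mesh \<Omega> M \<longleftrightarrow>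
     open \<Omega> \<and> connected \<Omega> \<and> bounded \<Omega> \<and> \<Omega> \<noteq> {} \<and>
     finite (cells M) \<and> finite (edges M) \<and>
     (\<forall>K\<in>cells M. K \<noteq> {} \<and> K \<subseteq> \<Omega> \<and> open K \<and> convex K \<and> polytope (closure K)) \<and>
     (\<forall>\<sigma>\<in>edges M. \<sigma> \<subseteq> closure \<Omega> \<and> (\<exists>a b. a \<noteq> 0 \<and> \<sigma> \<subseteq> {x. a \<bullet> x = b}) \<and> face_measure \<sigma> > 0) \<and>
     closure (\<Union>(cells M)) = closure \<Omega> \<and>
     (\<forall>K\<in>cells M. edges_of M K \<subseteq> edges M \<and> frontier K = (\<Union>\<sigma>\<in>edges_of M K. closure \<sigma>)) \<and>
     edges M = (\<Union>K\<in>cells M. edges_of M K) \<and>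
     (\<forall>K\<in>cells M. \<forall>L\<in>cells M. K \<noteq> L \<longrightarrow>
        K \<inter> L = {} \<and>
        (face_measure (closure K \<inter> closure L) = 0 \<or> (\<exists>\<sigma>. common_edge M K L \<sigma>))) \<and>
     (\<forall>K\<in>cells M. \<forall>\<sigma>\<in>edges_of M K. (\<exists>L. common_edge M K L \<sigma>) \<or> \<sigma> \<subseteq> frontier \<Omega>) \<and>
     (\<forall>K\<in>cells M. cell_point M K \<in> closure K) \<and>
     (\<forall>K L \<sigma>. common_edge M K L \<sigma> \<longrightarrow>
        cell_point M K \<noteq> cell_point M L \<and>
        (\<forall>y\<in>\<sigma>. \<forall>z\<in>\<sigma>. orthogonal (cell_point M L - cell_point M K) (z - y))) \<and>
     (\<forall>K\<in>cells M. \<forall>\<sigma>\<in>edges_of M K. \<sigma> \<subseteq> frontier \<Omega> \<longrightarrow>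
        cell_point M K \<notin> \<sigma> \<and>
        (\<exists>y\<in>\<sigma>. \<forall>z\<in>\<sigma>. orthogonal (cell_point M K - y) (z - y)))"

definition interior_edge :: "'a::euclidean_space fv_mesh \<Rightarrow> 'a set \<Rightarrow> 'a set \<Rightarrow> bool" where
  "interior_edge M K \<sigma> \<longleftrightarrow> (\<exists>L. common_edge M K L \<sigma>)"

text \<open>
  In an admissible mesh the neighbour of \<open>K\<close> across an interior edge is unique: two disjoint convex
  cells on the same side of \<open>\<sigma>\<close> cannot both have \<open>\<sigma>\<close> in their boundary.
\<close>

definition neighbour :: "'a::euclidean_space fv_mesh \<Rightarrow> 'a set \<Rightarrow> 'a set \<Rightarrow> 'a set" where
  "neighbour M K \<sigma> = (SOME L. common_edge M K L \<sigma>)"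

definition edge_dist :: "'a::euclidean_space fv_mesh \<Rightarrow> 'a set \<Rightarrow> 'a set \<Rightarrow> real" where
  "edge_dist M K \<sigma> =
     (if interior_edge M K \<sigma> then dist (cell_point M K) (cell_point M (neighbour M K \<sigma>))
      else infdist (cell_point M K) \<sigma>)"

definition transmissibility :: "'a::euclidean_space fv_mesh \<Rightarrow> 'a set \<Rightarrow> 'a set \<Rightarrow> real" where
  "transmissibility M K \<sigma> = face_measure \<sigma> / edge_dist M K \<sigma>"

definition dual_cell :: "'a::euclidean_space fv_mesh \<Rightarrow> 'a set \<Rightarrow> 'a set \<Rightarrow> 'a set" where
  "dual_cell M K \<sigma> =
     (if interior_edge M K \<sigma>
      then interior (convex hull (\<sigma> \<union> {cell_point M K, cell_point M (neighbour M K \<sigma>)}))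
      else interior (convex hull (\<sigma> \<union> {cell_point M K})))"


section \<open>Discrete functions and the Scharfetter-Gummel flux\<close>

text \<open>Values on the cells, together with given values on the exterior edges.\<close>

record 'a discrete_fun =
  cell_val :: "'a set \<Rightarrow> real"
  edge_val :: "'a set \<Rightarrow> real"

text \<open>\<open>outer_val M v K \<sigma>\<close> is the quantity written \<open>v\<close> with subscript \<open>K,\<sigma>\<close>.\<close>

definition outer_val ::
    "'a::euclidean_space fv_mesh \<Rightarrow> 'a discrete_fun \<Rightarrow> 'a set \<Rightarrow> 'a set \<Rightarrow> real" where
  "outer_val M v K \<sigma> =
     (if interior_edge M K \<sigma> then cell_val v (neighbour M K \<sigma>) else edge_val v \<sigma>)"

definition edge_diff ::
    "'a::euclidean_space fv_mesh \<Rightarrow> (real \<Rightarrow> real) \<Rightarrow> 'a discrete_fun \<Rightarrow> 'a set \<Rightarrow> 'a set \<Rightarrow> real" where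
  "edge_diff M f v K \<sigma> = f (outer_val M v K \<sigma>) - f (cell_val v K)"

definition positive_density :: "'a::euclidean_space fv_mesh \<Rightarrow> 'a discrete_fun \<Rightarrow> bool" where
  "positive_density M u \<longleftrightarrow>
     (\<forall>K\<in>cells M. cell_val u K > 0 \<and> (\<forall>\<sigma>\<in>edges_of M K. outer_val M u K \<sigma> > 0))"

definition bernoulli_fun :: "real \<Rightarrow> real" where
  "bernoulli_fun s = (if s = 0 then 1 else s / (exp s - 1))"

definition sg_flux ::
    "'a::euclidean_space fv_mesh \<Rightarrow> 'a discrete_fun \<Rightarrow> 'a discrete_fun \<Rightarrow> 'a set \<Rightarrow> 'a set \<Rightarrow> real" where
  "sg_flux M u \<phi> K \<sigma> =
     transmissibility M K \<sigma> *
       (bernoulli_fun (- edge_diff M (\<lambda>s. s) \<phi> K \<sigma>) * outer_val M u K \<sigma>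
        - bernoulli_fun (edge_diff M (\<lambda>s. s) \<phi> K \<sigma>) * cell_val u K)"

definition edge_production ::
    "'a::euclidean_space fv_mesh \<Rightarrow> 'a discrete_fun \<Rightarrow> 'a discrete_fun \<Rightarrow> 'a set \<Rightarrow> 'a set \<Rightarrow> real" where
  "edge_production M u \<phi> K \<sigma> =
     sg_flux M u \<phi> K \<sigma> * (edge_diff M ln u K \<sigma> + edge_diff M (\<lambda>s. s) \<phi> K \<sigma>)"

definition edge_mean ::
    "'a::euclidean_space fv_mesh \<Rightarrow> 'a discrete_fun \<Rightarrow> 'a set \<Rightarrow> 'a set \<Rightarrow> real" where
  "edge_mean M u K \<sigma> = ((sqrt (cell_val u K) + sqrt (outer_val M u K \<sigma>)) / 2)\<^sup>2"

end

theory Submission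
  imports Defs
begin

text \<open>
  Write \<open>a\<close>, \<open>b\<close> for the square roots of the two densities, \<open>y\<close> for the jump of the potential and
  \<open>\<delta>\<close> for \<open>d\<^sub>\<sigma>\<close>. After division by \<open>\<tau>\<^sub>\<sigma>\<close> the claim becomes a scalar inequality bounding \<open>\<delta> \<bar>b - a\<bar>\<close>.
  With \<open>c = a exp (- y / 2)\<close> the production equals \<open>B(- y) (b\<^sup>2 - c\<^sup>2) 2 ln (b / c)\<close>. For \<open>\<bar>y\<bar> \<le> 1\<close> it
  dominates \<open>(b - c)\<^sup>2\<close>, while \<open>\<bar>c - a\<bar> \<le> a \<bar>y\<bar>\<close>; for \<open>\<bar>y\<bar> > 1\<close> one has \<open>\<bar>b - a\<bar> \<le> (a + b) \<bar>y\<bar>\<close>.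
  Young's inequality concludes in both cases. The geometric input is \<open>m(\<sigma>) \<delta> \<le> C m(\<Delta>\<^sub>\<sigma>)\<close>: an edge of
  positive measure is not contained in a smaller affine subspace, so the orthogonality condition
  makes \<open>\<delta>\<close> at most the sum of the heights of the cell points over \<open>\<sigma>\<close>, and the dual cell contains the
  cones over \<open>\<sigma>\<close> up to a null set.
\<close>

subsection \<open>Lebesgue measure in an orthonormal basis\<close>

lemma nn_integral_lborel_plus:
  fixes f :: "'a::euclidean_space \<Rightarrow> ennreal"
  assumes [measurable]: "f \<in> borel_measurable borel"
  shows "(\<integral>\<^sup>+x. f (c + x) \<partial>lborel) = (\<integral>\<^sup>+x. f x \<partial>lborel)"
  by (subst (2) lborel_distr_plus[of c, symmetric]) (simp add: nn_integral_distr)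

text \<open>For \<open>T\<close> orthogonal and \<open>B\<close> the unit ball, evaluate the double integral of \<open>1\<^sub>A(y + T x) 1\<^sub>B(y)\<close> in both
  orders: translation invariance turns it into both sides of the identity, multiplied by \<open>m(B)\<close>.\<close>

lemma distr_lborel_orthogonal_transformation:
  fixes T :: "'a::euclidean_space \<Rightarrow> 'a"
  assumes T: "orthogonal_transformation T"
  shows "distr lborel borel T = lborel"
proof (rule measure_eqI)
  fix A assume "A \<in> sets (distr lborel borel T)"
  then have [measurable]: "A \<in> sets borel" by simp
  have lin: "linear T" and surj: "surj T"
    using T by (auto simp: orthogonal_transformation_linear orthogonal_transformation_surj)
  have [measurable]: "T \<in> borel_measurable borel"
    using lin by (simp add: borel_measurable_continuous_onI linear_continuous_on linear_conv_bounded_linear)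
  define B where "B = ball (0::'a) 1"
  have [measurable]: "B \<in> sets borel" by (simp add: B_def)
  \<comment> \<open>As \<open>T\<close> is onto, a translation by \<open>y\<close> after
    \<open>T\<close> is a translation by a preimage of \<open>y\<close> before
    \<open>T\<close>.\<close>
  have shift: "(\<integral>\<^sup>+x. indicator A (T x) \<partial>lborel) = (\<integral>\<^sup>+x. indicator A (y + T x) \<partial>lborel)" for y
  proof -
    obtain z where "y = T z" using surj by (metis surjD)
    then show ?thesis
      using nn_integral_lborel_plus[of "\<lambda>x. indicator A (T x)" z] by (simp add: linear_add[OF lin])
  qed
  \<comment> \<open>With \<open>y = T z\<close> the argument is \<open>T (z - x)\<close>, and the
    isometry \<open>T\<close> preserves norms, so this is the volume of a translated ball.\<close>
  have ball: "(\<integral>\<^sup>+x. indicator B (y - T x) \<partial>lborel) = emeasure lborel B" for y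
  proof -
    obtain z where z: "y = T z" using surj by (metis surjD)
    have "indicator B (y - T x) = (indicator B (- z + x) :: ennreal)" for x
      using T by (simp add: z B_def indicator_def dist_norm orthogonal_transformation_norm norm_minus_commute
          flip: linear_diff[OF lin])
    then show ?thesis
      using nn_integral_lborel_plus[of "indicator B" "- z"] by simp
  qed
  have "emeasure (distr lborel borel T) A * emeasure lborel B
      = (\<integral>\<^sup>+y. (\<integral>\<^sup>+x. indicator A (T x) \<partial>lborel) * indicator B y \<partial>lborel)"
    using nn_integral_distr[of T lborel borel "indicator A"] by (simp add: nn_integral_cmult)
  also have "\<dots> = (\<integral>\<^sup>+y. (\<integral>\<^sup>+x. indicator A (y + T x) * indicator B y \<partial>lborel) \<partial>lborel)"
    by (intro nn_integral_cong, subst shift, rule nn_integral_multc[symmetric]) measurable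
  also have "\<dots> = (\<integral>\<^sup>+x. (\<integral>\<^sup>+y. indicator A (y + T x) * indicator B y \<partial>lborel) \<partial>lborel)"
    by (rule lborel_pair.Fubini') measurable
  also have "\<dots> = (\<integral>\<^sup>+x. (\<integral>\<^sup>+y. indicator A y * indicator B (y - T x) \<partial>lborel) \<partial>lborel)"
  proof (rule nn_integral_cong)
    fix x
    show "(\<integral>\<^sup>+y. indicator A (y + T x) * indicator B y \<partial>lborel)
        = (\<integral>\<^sup>+y. indicator A y * indicator B (y - T x) \<partial>lborel)"
      using nn_integral_lborel_plus[of "\<lambda>y. indicator A y * indicator B (y - T x)" "T x"]
      by (simp add: add.commute)
  qed
  also have "\<dots> = (\<integral>\<^sup>+y. (\<integral>\<^sup>+x. indicator A y * indicator B (y - T x) \<partial>lborel) \<partial>lborel)"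
    by (rule lborel_pair.Fubini'[symmetric]) measurable
  also have "\<dots> = emeasure lborel A * emeasure lborel B"
    by (subst nn_integral_cmult) (auto simp: ball nn_integral_multc)
  finally have "emeasure (distr lborel borel T) A * emeasure lborel B
      = emeasure lborel A * emeasure lborel B" .
  \<comment> \<open>Positivity and finiteness of this volume permit cancellation in the extended
    reals.\<close>
  moreover have "emeasure lborel B \<noteq> 0" "emeasure lborel B \<noteq> \<infinity>"
    using emeasure_lborel_ball_finite[of "0::'a" 1] content_ball_pos[of 1 "0::'a"]
    by (auto simp: B_def emeasure_eq_ennreal_measure)
  ultimately show "emeasure (distr lborel borel T) A = emeasure lborel A"
    by (metis ennreal_mult_divide_eq infinity_ennreal_def)
qed simp

text \<open>The preimage of a box under relabelling is the box with relabelled sides, and boxes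
  determine a product measure.\<close>

lemma distr_PiM_reindex_bij_betw:
  fixes N :: "'b measure" and \<pi> :: "'i \<Rightarrow> 'j"
  assumes "finite I" and bij: "bij_betw \<pi> I J" and "sigma_finite_measure N"
  shows "distr (Pi\<^sub>M J (\<lambda>_. N)) (Pi\<^sub>M I (\<lambda>_. N)) (\<lambda>f. \<lambda>i\<in>I. f (\<pi> i)) = Pi\<^sub>M I (\<lambda>_. N)"
proof -
  interpret I: product_sigma_finite "\<lambda>_::'i. N" by (rule product_sigma_finite.intro) fact
  interpret J: product_sigma_finite "\<lambda>_::'j. N" by (rule product_sigma_finite.intro) fact
  have "finite J" using assms bij_betw_finite by blast
  have \<pi>: "\<pi> i \<in> J" if "i \<in> I" for i using that bij by (auto simp: bij_betw_def)
  have inv: "the_inv_into I \<pi> j \<in> I" "\<pi> (the_inv_into I \<pi> j) = j" if "j \<in> J" for j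
    using that bij by (auto simp: bij_betw_def f_the_inv_into_f the_inv_into_into)
  have inv': "the_inv_into I \<pi> (\<pi> i) = i" if "i \<in> I" for i
    using that bij by (auto simp: bij_betw_def the_inv_into_f_f)
  have [measurable]: "(\<lambda>f. \<lambda>i\<in>I. f (\<pi> i)) \<in> Pi\<^sub>M J (\<lambda>_. N) \<rightarrow>\<^sub>M Pi\<^sub>M I (\<lambda>_. N)"
    by (intro measurable_restrict measurable_component_singleton \<pi>)
  show ?thesis
  proof (rule I.PiM_eqI)
    fix A :: "'i \<Rightarrow> 'b set" assume A: "\<And>i. i \<in> I \<Longrightarrow> A i \<in> sets N"
    have "(\<lambda>f. \<lambda>i\<in>I. f (\<pi> i)) -` Pi\<^sub>E I A \<inter> space (Pi\<^sub>M J (\<lambda>_. N))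
        = Pi\<^sub>E J (\<lambda>j. A (the_inv_into I \<pi> j))"
      using A[THEN sets.sets_into_space] inv inv' \<pi>
      by (auto simp: space_PiM PiE_iff extensional_def) (metis subsetD)+
    moreover have "(\<Prod>j\<in>J. emeasure N (A (the_inv_into I \<pi> j))) = (\<Prod>i\<in>I. emeasure N (A i))"
      using bij inv' by (subst prod.reindex_bij_betw[symmetric, OF bij]) (auto intro!: prod.cong)
    ultimately show "emeasure (distr (Pi\<^sub>M J (\<lambda>_. N)) (Pi\<^sub>M I (\<lambda>_. N)) (\<lambda>f. \<lambda>i\<in>I. f (\<pi> i))) (Pi\<^sub>E I A)
        = (\<Prod>i\<in>I. emeasure N (A i))"
      using A inv \<open>finite I\<close> \<open>finite J\<close>
      by (simp add: emeasure_distr sets_PiM_I_finite J.emeasure_PiM)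
  qed (use assms in auto)
qed

text \<open>The linear map taking the standard basis to \<open>B\<close> is orthogonal, hence
  preserves \<open>lborel\<close>, which is the image of the product measure under standard
  coordinates; these are then relabelled by \<open>B\<close>.\<close>

lemma lborel_eq_distr_orthonormal_basis:
  fixes B :: "'a::euclidean_space set"
  assumes orth: "pairwise orthogonal B" and norm: "\<And>b. b \<in> B \<Longrightarrow> norm b = 1"
    and card: "card B = DIM('a)"
  shows "lborel = distr (Pi\<^sub>M B (\<lambda>_. lborel)) borel (\<lambda>f. \<Sum>b\<in>B. f b *\<^sub>R b)"
proof -
  have fin: "finite B" using card card_ge_0_finite by force
  obtain \<pi> where \<pi>: "bij_betw \<pi> (Basis :: 'a set) B"
    using finite_same_card_bij[OF finite_Basis fin] card by auto
  define T where "T x = (\<Sum>b\<in>Basis. (x \<bullet> b) *\<^sub>R \<pi> b)" for x :: 'a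
  have in_B: "\<pi> b \<in> B" if "b \<in> Basis" for b using \<pi> that by (auto simp: bij_betw_def)
  have "linear T"
    unfolding T_def by (intro linearI) (simp_all add: inner_add_left scaleR_add_left sum.distrib scaleR_sum_right)
  have inner_\<pi>: "\<pi> i \<bullet> \<pi> j = (if i = j then 1 else 0)" if "i \<in> Basis" "j \<in> Basis" for i j
    using that orth in_B norm \<pi>
    by (auto simp: pairwise_def orthogonal_def bij_betw_def inj_on_def dot_square_norm) metis+
  have orth_T: "T v \<bullet> T w = v \<bullet> w" for v w
    by (simp add: T_def inner_sum_left inner_sum_right inner_\<pi> if_distrib sum.If_cases
        euclidean_inner[of v w] mult.commute cong: if_cong)
  have [measurable]: "T \<in> borel_measurable borel"
    using \<open>linear T\<close> by (simp add: borel_measurable_continuous_onI linear_continuous_on linear_conv_bounded_linear)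
  from \<open>linear T\<close> orth_T have "orthogonal_transformation T"
    by (simp add: orthogonal_transformation_def)
  then have "lborel = distr lborel borel T"
    by (rule distr_lborel_orthogonal_transformation[symmetric])
  also have "distr lborel borel T = distr (distr (\<Pi>\<^sub>M b\<in>Basis. lborel) borel (\<lambda>f. \<Sum>b\<in>Basis. f b *\<^sub>R b)) borel T"
    by (rule arg_cong[where f="\<lambda>M. distr M borel T"]) (rule lborel_eq)
  also have "(\<Pi>\<^sub>M b\<in>(Basis::'a set). lborel) = distr (Pi\<^sub>M B (\<lambda>_. lborel)) (\<Pi>\<^sub>M b\<in>(Basis::'a set). lborel) (\<lambda>f. \<lambda>i\<in>Basis. f (\<pi> i))"
    by (rule distr_PiM_reindex_bij_betw[symmetric, OF finite_Basis \<pi>]) (rule sigma_finite_lborel)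
  also have "distr (distr (distr (Pi\<^sub>M B (\<lambda>_. lborel)) (\<Pi>\<^sub>M b\<in>(Basis::'a set). lborel)
        (\<lambda>f. \<lambda>i\<in>Basis. f (\<pi> i))) borel (\<lambda>f. \<Sum>b\<in>Basis. f b *\<^sub>R b)) borel T
      = distr (Pi\<^sub>M B (\<lambda>_. lborel)) borel (T \<circ> (\<lambda>f. \<Sum>b\<in>Basis. f b *\<^sub>R b) \<circ> (\<lambda>f. \<lambda>i\<in>Basis. f (\<pi> i)))"
    using in_B by (simp add: distr_distr comp_assoc)
  also have "T \<circ> (\<lambda>f. \<Sum>b\<in>Basis. f b *\<^sub>R b) \<circ> (\<lambda>f. \<lambda>i\<in>Basis. f (\<pi> i)) = (\<lambda>f. \<Sum>b\<in>B. f b *\<^sub>R b)"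
    by (auto simp: fun_eq_iff T_def inner_sum_left inner_Basis if_distrib sum.If_cases
        simp flip: sum.reindex_bij_betw[OF \<pi>] cong: if_cong)
  finally show ?thesis .
qed

text \<open>Each coordinate contributes one factor \<open>t\<close>, and checking boxes suffices.
  This serves to compare slices of a cone with scaled copies of its base.\<close>

lemma emeasure_PiM_affine:
  fixes B :: "'b set" and D :: "('b \<Rightarrow> real) set"
  assumes "finite B" and t: "t > 0" and D: "D \<in> sets (Pi\<^sub>M B (\<lambda>_. lborel))"
  shows "emeasure (Pi\<^sub>M B (\<lambda>_. lborel)) D
    = ennreal (t ^ card B) * emeasure (Pi\<^sub>M B (\<lambda>_. lborel)) {c \<in> B \<rightarrow>\<^sub>E UNIV. (\<lambda>b\<in>B. \<xi> b + t * c b) \<in> D}"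
proof -
  let ?P = "Pi\<^sub>M B (\<lambda>_. lborel) :: ('b \<Rightarrow> real) measure"
  let ?g = "\<lambda>c. \<lambda>b\<in>B. \<xi> b + t * c b"
  interpret P: product_sigma_finite "\<lambda>_::'b. lborel :: real measure"
    by (rule product_sigma_finite.intro) (rule sigma_finite_lborel)
  have [measurable]: "?g \<in> ?P \<rightarrow>\<^sub>M ?P" by measurable
  have "density (distr ?P ?P ?g) (\<lambda>_. ennreal (t ^ card B)) = ?P"
  proof (rule P.PiM_eqI)
    fix A :: "'b \<Rightarrow> real set" assume "\<And>i. i \<in> B \<Longrightarrow> A i \<in> sets lborel"
    then have A[measurable]: "\<And>i. i \<in> B \<Longrightarrow> A i \<in> sets borel" by simp
    have "?g -` Pi\<^sub>E B A \<inter> space ?P = Pi\<^sub>E B (\<lambda>b. (\<lambda>x. \<xi> b + t * x) -` A b)"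
      by (auto simp: space_PiM PiE_iff)
    moreover have vim: "(\<lambda>x. \<xi> b + t * x) -` A b \<in> sets borel" if "b \<in> B" for b
      using measurable_sets[of "\<lambda>x. \<xi> b + t * x" borel borel "A b"] A[OF that] by simp
    moreover have "emeasure lborel (A b) = ennreal t * emeasure lborel ((\<lambda>x. \<xi> b + t * x) -` A b)" if "b \<in> B" for b
      using t A[OF that]
      by (subst lborel_real_affine[of t "\<xi> b"]) (auto simp: emeasure_density nn_integral_cmult emeasure_distr)
    moreover have "Pi\<^sub>E B A \<in> sets ?P"
      using A by (intro sets_PiM_I_finite \<open>finite B\<close>) auto
    ultimately show "emeasure (density (distr ?P ?P ?g) (\<lambda>_. ennreal (t ^ card B))) (Pi\<^sub>E B A)
        = (\<Prod>i\<in>B. emeasure lborel (A i))"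
      using \<open>finite B\<close> t
      by (simp add: emeasure_density nn_integral_cmult emeasure_distr P.emeasure_PiM prod.distrib ennreal_power)
  qed (use assms in auto)
  then have "emeasure ?P D = emeasure (density (distr ?P ?P ?g) (\<lambda>_. ennreal (t ^ card B))) D"
    by simp
  also have "\<dots> = ennreal (t ^ card B) * emeasure ?P (?g -` D \<inter> space ?P)"
    using D by (simp add: emeasure_density nn_integral_cmult emeasure_distr)
  also have "?g -` D \<inter> space ?P = {c \<in> B \<rightarrow>\<^sub>E UNIV. ?g c \<in> D}"
    by (auto simp: space_PiM)
  finally show ?thesis .
qed

text \<open>Edges are not assumed measurable. For a nonmeasurable set, and for one of infinite
  measure, \<open>measure\<close> takes the value 0, which is harmless on this side of the
  bound.\<close>

lemma measure_completion_le:
  assumes "S \<subseteq> D" "D \<in> sets M"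
  shows "ennreal (measure (completion M) S) \<le> emeasure M D"
proof (cases "S \<in> sets (completion M)")
  case True
  have "ennreal (measure (completion M) S) \<le> emeasure (completion M) S"
    by (simp add: Sigma_Algebra.measure_def ennreal_enn2real_if)
  also have "\<dots> \<le> emeasure (completion M) D"
    using assms by (intro emeasure_mono) auto
  also have "\<dots> = emeasure M D"
    using assms by (simp add: emeasure_completion)
  finally show ?thesis .
qed (simp add: measure_notin_sets)

subsection \<open>Slices parallel to a hyperplane\<close>

text \<open>Cartesian coordinates adapted to a hyperplane through \<open>p\<close>. The point
  \<open>p\<close> is arbitrary, so the locale predicate has only the arguments \<open>B\<close> and
  \<open>n\<close>.\<close>

locale unit_normal_frame =
  fixes B :: "'a::euclidean_space set" and p n :: 'a
  assumes finite_B: "finite B" and card_B: "card B = DIM('a) - 1"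
    and orth_B: "pairwise orthogonal B" and norm_B: "\<And>b. b \<in> B \<Longrightarrow> norm b = 1"
    and norm_n: "norm n = 1" and normal: "\<And>b. b \<in> B \<Longrightarrow> n \<bullet> b = 0"
begin

text \<open>At height 0, in the chosen frame, this is the coordinate set measured by
  \<open>face_measure\<close>; other heights give the parallel sections.\<close>

definition slice :: "'a set \<Rightarrow> real \<Rightarrow> ('a \<Rightarrow> real) set" where
  "slice A s = {c \<in> B \<rightarrow>\<^sub>E UNIV. p + (\<Sum>b\<in>B. c b *\<^sub>R b) + s *\<^sub>R n \<in> A}"

abbreviation P :: "('a \<Rightarrow> real) measure" where "P \<equiv> Pi\<^sub>M B (\<lambda>_. lborel)"

lemma n_notin: "n \<notin> B"
  using normal[of n] norm_n by auto

lemma normal_span: "v \<in> span B \<Longrightarrow> n \<bullet> v = 0"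
  using orthogonal_to_span[of v B n] normal by (auto simp: orthogonal_def)

lemma orthonormal_insert:
  "pairwise orthogonal (insert n B)" "\<And>b. b \<in> insert n B \<Longrightarrow> norm b = 1" "card (insert n B) = DIM('a)"
  using orth_B norm_B norm_n normal finite_B n_notin card_B
  by (auto simp: pairwise_insert orthogonal_def inner_commute)

lemma expand: "(\<Sum>b\<in>B. (x \<bullet> b) *\<^sub>R b) + (x \<bullet> n) *\<^sub>R n = x"
proof -
  have "0 \<notin> insert n B" using orthonormal_insert(2) by force
  then have "independent (insert n B)"
    using orthonormal_insert(1) pairwise_orthogonal_independent by blast
  then have "dim (span (insert n B)) = DIM('a)"
    using orthonormal_insert(3) by (simp add: dim_eq_card_independent)
  then have "x \<in> span (insert n B)"
    by (metis UNIV_I dim_eq_full span_span)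
  then have "(\<Sum>b\<in>insert n B. (x \<bullet> b) *\<^sub>R b) = x"
    using orthonormal_insert finite_B by (intro orthonormal_basis_expand) auto
  then show ?thesis
    using finite_B n_notin by (simp add: add.commute)
qed

lemma sets_slice [measurable]:
  assumes [measurable]: "A \<in> sets borel"
  shows "slice A s \<in> sets P"
proof -
  have "slice A s = {c \<in> space P. p + (\<Sum>b\<in>B. c b *\<^sub>R b) + s *\<^sub>R n \<in> A}"
    by (auto simp: slice_def space_PiM)
  then show ?thesis by simp
qed

text \<open>Cavalieri's principle: in the orthonormal coordinates of \<open>insert n B\<close>, the
  coordinate along \<open>n\<close> becomes the outer integral.\<close>

lemma emeasure_lborel_slice:
  assumes [measurable]: "A \<in> sets borel"
  shows "emeasure lborel A = (\<integral>\<^sup>+s. emeasure P (slice A s) \<partial>lborel)"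
proof -
  interpret L: product_sigma_finite "\<lambda>_::'a. lborel :: real measure"
    by (rule product_sigma_finite.intro) (rule sigma_finite_lborel)
  let ?f = "\<lambda>f. \<Sum>b\<in>insert n B. f b *\<^sub>R b"
  have "emeasure lborel A = (\<integral>\<^sup>+x. indicator A (p + x) \<partial>lborel)"
    using nn_integral_lborel_plus[of "indicator A" p] by simp
  also have "\<dots> = (\<integral>\<^sup>+f. indicator A (p + ?f f) \<partial>Pi\<^sub>M (insert n B) (\<lambda>_. lborel))"
    by (subst lborel_eq_distr_orthonormal_basis[OF orthonormal_insert]) (simp_all add: nn_integral_distr)
  also have "\<dots> = (\<integral>\<^sup>+s. (\<integral>\<^sup>+c. indicator A (p + ?f (c(n := s))) \<partial>P) \<partial>lborel)"
    using finite_B n_notin by (intro L.product_nn_integral_insert_rev) simp_all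
  also have "\<dots> = (\<integral>\<^sup>+s. (\<integral>\<^sup>+c. indicator (slice A s) c \<partial>P) \<partial>lborel)"
  proof (intro nn_integral_cong)
    fix s c assume "c \<in> space P"
    moreover have "?f (c(n := s)) = (\<Sum>b\<in>B. c b *\<^sub>R b) + s *\<^sub>R n"
    proof -
      have "(\<Sum>b\<in>B. (c(n := s)) b *\<^sub>R b) = (\<Sum>b\<in>B. c b *\<^sub>R b)"
        using n_notin by (intro sum.cong) auto
      then show ?thesis using finite_B n_notin by (simp add: add.commute)
    qed
    ultimately show "indicator A (p + ?f (c(n := s))) = (indicator (slice A s) c :: ennreal)"
      by (auto simp: slice_def space_PiM indicator_def add.assoc)
  qed
  finally show ?thesis by simp
qed

text \<open>Since \<open>v\<close> is orthogonal to \<open>n\<close>, the hyperplane normal to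
  \<open>v\<close> has the same slice at every height. If that slice had positive measure, the
  hyperplane would have infinite volume, yet it is a null set.\<close>

lemma measure_slice_eq_0:
  assumes "v \<noteq> 0" "v \<bullet> n = 0" "S \<subseteq> {x. v \<bullet> x = k}"
  shows "measure (completion P) (slice S 0) = 0"
proof -
  let ?A = "{x. v \<bullet> x = k}"
  have [measurable]: "?A \<in> sets borel" by (simp add: closed_hyperplane)
  have "slice ?A s = slice ?A 0" for s
    using assms(2) by (auto simp: slice_def inner_add_right)
  then have "(\<integral>\<^sup>+(s::real). emeasure P (slice ?A 0) \<partial>lborel) = (\<integral>\<^sup>+s. emeasure P (slice ?A s) \<partial>lborel)"
    by (intro nn_integral_cong) metis
  also have "\<dots> = emeasure lborel ?A"
    by (rule emeasure_lborel_slice[symmetric]) simp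
  also have "\<dots> = 0"
    using negligible_hyperplane[of v k] assms(1) by (simp add: negligible_iff_null_sets null_sets_completion_iff null_sets_def)
  finally have "emeasure P (slice ?A 0) = 0"
    by (simp add: ennreal_mult_eq_top_iff)
  moreover have "slice S 0 \<subseteq> slice ?A 0" using assms(3) by (auto simp: slice_def)
  ultimately have "ennreal (measure (completion P) (slice S 0)) \<le> 0"
    using measure_completion_le[of "slice S 0" "slice ?A 0" P] by simp
  then show ?thesis by simp
qed

text \<open>At a height at most half that of the apex, the slice of the cone contains a copy of the base
  scaled by a factor at least \<open>1/2\<close>.\<close>

lemma slice_convex_ge:
  assumes H: "convex H" "H \<in> sets borel" and S: "S \<subseteq> H" and x: "x \<in> H"
    and r: "1/2 \<le> r" "r \<le> 1"
  shows "ennreal ((1/2) ^ card B * measure (completion P) (slice S 0))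
    \<le> emeasure P (slice H ((1 - r) * ((x - p) \<bullet> n)))"
proof -
  define D where "D = slice H ((1 - r) * ((x - p) \<bullet> n))"
  \<comment> \<open>In coordinates, \<open>c \<mapsto> \<xi> + r * c\<close> is the homothety with
    centre \<open>x\<close> and ratio \<open>r\<close>, applied to the base.\<close>
  define \<xi> where "\<xi> b = (1 - r) * ((x - p) \<bullet> b)" for b
  have D: "D \<in> sets P" using H(2) by (simp add: D_def)
  have sub: "slice S 0 \<subseteq> {c \<in> B \<rightarrow>\<^sub>E UNIV. (\<lambda>b\<in>B. \<xi> b + r * c b) \<in> D}"
  proof
    fix c assume c: "c \<in> slice S 0"
    define y where "y = p + (\<Sum>b\<in>B. c b *\<^sub>R b)"
    have "y \<in> H" using c S by (auto simp: slice_def y_def)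
    then have "(1 - r) *\<^sub>R x + r *\<^sub>R y \<in> H"
      using H(1) x r by (intro convexD) auto
    moreover have "p + (\<Sum>b\<in>B. (\<lambda>b\<in>B. \<xi> b + r * c b) b *\<^sub>R b) + ((1 - r) * ((x - p) \<bullet> n)) *\<^sub>R n
        = (1 - r) *\<^sub>R x + r *\<^sub>R y"
    proof -
      define X where "X = (\<Sum>b\<in>B. ((x - p) \<bullet> b) *\<^sub>R b)"
      define Y where "Y = (\<Sum>b\<in>B. c b *\<^sub>R b)"
      have "(\<Sum>b\<in>B. (\<lambda>b\<in>B. \<xi> b + r * c b) b *\<^sub>R b) = (1 - r) *\<^sub>R X + r *\<^sub>R Y"
        by (simp add: \<xi>_def X_def Y_def scaleR_add_left sum.distrib scaleR_sum_right)
      moreover have "(1 - r) *\<^sub>R (x - p) = (1 - r) *\<^sub>R X + ((1 - r) * ((x - p) \<bullet> n)) *\<^sub>R n"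
        unfolding X_def by (subst expand[of "x - p", symmetric]) (simp add: scaleR_add_right)
      then have "p + ((1 - r) *\<^sub>R X + r *\<^sub>R Y) + ((1 - r) * ((x - p) \<bullet> n)) *\<^sub>R n
          = p + (1 - r) *\<^sub>R (x - p) + r *\<^sub>R Y"
        by (simp add: ac_simps)
      moreover have "p + (1 - r) *\<^sub>R (x - p) + r *\<^sub>R Y = (1 - r) *\<^sub>R x + r *\<^sub>R y"
        by (simp add: y_def Y_def[symmetric] algebra_simps)
      ultimately show ?thesis by simp
    qed
    ultimately show "c \<in> {c \<in> B \<rightarrow>\<^sub>E UNIV. (\<lambda>b\<in>B. \<xi> b + r * c b) \<in> D}"
      using c by (auto simp: D_def slice_def)
  qed
  have meas: "{c \<in> B \<rightarrow>\<^sub>E UNIV. (\<lambda>b\<in>B. \<xi> b + r * c b) \<in> D} \<in> sets P"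
  proof -
    have "(\<lambda>c. \<lambda>b\<in>B. \<xi> b + r * c b) \<in> P \<rightarrow>\<^sub>M P" by measurable
    from measurable_sets[OF this D] show ?thesis
      by (simp add: vimage_def Int_def space_PiM conj_commute)
  qed
  \<comment> \<open>The bound \<open>(1/2) ^ card B\<close> for \<open>r ^ card B\<close> is uniform
    in the height.\<close>
  have "ennreal ((1/2) ^ card B * measure (completion P) (slice S 0))
      \<le> ennreal (r ^ card B) * ennreal (measure (completion P) (slice S 0))"
    using r by (subst ennreal_mult[symmetric]) (auto intro!: ennreal_leI mult_right_mono power_mono)
  also have "\<dots> \<le> ennreal (r ^ card B) * emeasure P {c \<in> B \<rightarrow>\<^sub>E UNIV. (\<lambda>b\<in>B. \<xi> b + r * c b) \<in> D}"
    using measure_completion_le[OF sub meas] by (rule mult_left_mono) simp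
  also have "\<dots> = emeasure P D"
    using emeasure_PiM_affine[OF finite_B _ D, of r \<xi>] r by simp
  finally show ?thesis by (simp add: D_def)
qed

text \<open>Only heights from 0 to half that of the apex are integrated. The length of this range
  and the lower bound for its slices contribute \<open>1/2\<close> and
  \<open>(1/2) ^ card B\<close>, and \<open>card B + 1 = DIM('a)\<close>.\<close>

lemma measure_cone_ge:
  assumes H: "convex H" "closed H" "bounded H" and S: "S \<subseteq> H" and x: "x \<in> H"
  shows "\<bar>(x - p) \<bullet> n\<bar> * measure (completion P) (slice S 0) \<le> 2 ^ DIM('a) * measure lborel H"
proof -
  define \<eta> where "\<eta> = (x - p) \<bullet> n"
  define k where "k = (1/2) ^ card B * measure (completion P) (slice S 0)"
  have "k \<ge> 0" by (simp add: k_def)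
  have [measurable]: "H \<in> sets borel" using H(2) by simp
  \<comment> \<open>The segment covers both signs of \<open>\<eta>\<close>.\<close>
  have "emeasure lborel (closed_segment 0 (\<eta> / 2)) = ennreal (\<bar>\<eta>\<bar> / 2)"
    by (auto simp: closed_segment_eq_real_ivl)
  then have "ennreal (\<bar>\<eta>\<bar> / 2 * k) = (\<integral>\<^sup>+s. ennreal k * indicator (closed_segment 0 (\<eta> / 2)) s \<partial>lborel)"
    using \<open>k \<ge> 0\<close> ennreal_mult[of k "\<bar>\<eta>\<bar> / 2"] by (simp add: nn_integral_cmult mult.commute)
  also have "\<dots> \<le> (\<integral>\<^sup>+s. emeasure P (slice H s) \<partial>lborel)"
  proof (intro nn_integral_mono)
    fix s :: real
    show "ennreal k * indicator (closed_segment 0 (\<eta> / 2)) s \<le> emeasure P (slice H s)"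
    proof (cases "s \<in> closed_segment 0 (\<eta> / 2)")
      case True
      then obtain u where u: "0 \<le> u" "u \<le> 1" "s = u * (\<eta> / 2)"
        by (auto simp: in_segment)
      \<comment> \<open>The ratio of the homothety is \<open>1 - u / 2\<close>, which stays between
        \<open>1/2\<close> and 1.\<close>
      then have s: "s = (1 - (1 - u / 2)) * ((x - p) \<bullet> n)" by (simp add: \<eta>_def)
      have "ennreal k \<le> emeasure P (slice H s)"
        unfolding k_def s by (rule slice_convex_ge[OF H(1) _ S x]) (use u in auto)
      with True show ?thesis by simp
    qed simp
  qed
  also have "\<dots> = emeasure lborel H"
    by (simp add: emeasure_lborel_slice)
  also have "\<dots> = ennreal (measure lborel H)"
    using emeasure_bounded_finite[OF H(3)] by (simp add: emeasure_eq_ennreal_measure)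
  finally have "\<bar>\<eta>\<bar> / 2 * k \<le> measure lborel H"
    by simp
  moreover have "DIM('a) = Suc (card B)" using card_B DIM_positive[where 'a='a] by simp
  ultimately show ?thesis
    by (simp add: \<eta>_def k_def field_simps)
qed

end

text \<open>The frame obtained is the very one selected by \<open>SOME\<close>, so
  \<open>face_measure\<close> becomes the measure of a slice without a change of coordinates.
  Existence of a frame is what makes that selection meaningful.\<close>

lemma face_measure_frame:
  fixes S :: "'a::euclidean_space set"
  assumes "a \<noteq> 0" "S \<subseteq> {x. a \<bullet> x = b}"
  obtains B p n where "unit_normal_frame B n" "S \<subseteq> {p + v |v. v \<in> span B}"
    "face_measure S = measure (completion (Pi\<^sub>M B (\<lambda>_. lborel))) (unit_normal_frame.slice B p n S 0)"
proof -
  have "\<exists>p B. orthonormal_frame S p B"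
  proof -
    obtain B where B: "B \<subseteq> {x. a \<bullet> x = 0}" "pairwise orthogonal B" "\<And>x. x \<in> B \<Longrightarrow> norm x = 1"
        "independent B" "card B = dim {x. a \<bullet> x = 0}" "span B = {x. a \<bullet> x = 0}"
      using orthonormal_basis_subspace[OF subspace_hyperplane[of a]] by metis
    \<comment> \<open>The foot of the perpendicular from the origin to the hyperplane.\<close>
    define p where "p = (b / (a \<bullet> a)) *\<^sub>R a"
    have "a \<bullet> p = b" using assms(1) by (simp add: p_def)
    then have "x - p \<in> span B" if "x \<in> S" for x
      using that assms(2) B(6) by (auto simp: inner_diff_right)
    then have "S \<subseteq> {p + v |v. v \<in> span B}"
      by (force intro: exI[of _ "_ - p"])
    then have "orthonormal_frame S p B"
      using B assms(1) by (simp add: orthonormal_frame_def dim_hyperplane independent_imp_finite)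
    then show ?thesis by blast
  qed
  then have ex: "\<exists>q. (\<lambda>(p, B). orthonormal_frame S p B) q" by auto
  obtain p B where pB: "(SOME (p, B). orthonormal_frame S p B) = (p, B)" by (meson surj_pair)
  have frame: "orthonormal_frame S p B" using someI_ex[OF ex] pB by simp
  \<comment> \<open>Fewer than \<open>DIM('a)\<close> directions leave a nonzero vector orthogonal
    to \<open>span B\<close>, which is then normalised.\<close>
  have "dim B \<le> card B"
    using frame by (intro dim_le_card') (simp add: orthonormal_frame_def)
  moreover have "card B < DIM('a)"
    using frame DIM_positive[where 'a='a] unfolding orthonormal_frame_def by linarith
  ultimately have "dim B < DIM('a)" by simp
  then obtain m where m: "m \<noteq> 0" "\<And>y. y \<in> span B \<Longrightarrow> orthogonal m y"
    using orthogonal_to_subspace_exists by blast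
  define n where "n = m /\<^sub>R norm m"
  have *: "unit_normal_frame B n"
    using frame m by unfold_locales (auto simp: orthonormal_frame_def n_def orthogonal_def span_base)
  show thesis
  proof (rule that[OF *])
    show "S \<subseteq> {p + v |v. v \<in> span B}" using frame by (simp add: orthonormal_frame_def)
    show "face_measure S = measure (completion (Pi\<^sub>M B (\<lambda>_. lborel))) (unit_normal_frame.slice B p n S 0)"
      using pB by (simp add: face_measure_def unit_normal_frame.slice_def[OF *])
  qed
qed

subsection \<open>The Scharfetter-Gummel production\<close>

lemma bernoulli_fun_pos: "bernoulli_fun s > 0"
  by (auto simp: bernoulli_fun_def zero_less_divide_iff)

text \<open>This allows \<open>bernoulli_fun (- y)\<close> to be factored out of the flux.\<close>

lemma bernoulli_fun_uminus: "bernoulli_fun s = exp (- s) * bernoulli_fun (- s)"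
proof (cases "s = 0")
  case False
  then have "exp s - 1 \<noteq> 0" "exp (- s) - 1 \<noteq> 0" by auto
  then show ?thesis using False
    by (simp add: bernoulli_fun_def field_simps exp_minus)
qed (simp add: bernoulli_fun_def)

text \<open>For negative \<open>s\<close> the tangent bound \<open>1 + s \<le> exp s\<close> even
  gives 1; for \<open>0 < s \<le> 1\<close> the quadratic bound gives
  \<open>exp s - 1 \<le> 2 * s\<close>.\<close>

lemma bernoulli_fun_ge_half:
  assumes "s \<le> 1"
  shows "bernoulli_fun s \<ge> 1 / 2"
proof -
  consider "s = 0" | "s < 0" | "0 < s" by linarith
  then show ?thesis
  proof cases
    case 2
    have "1 + s \<le> exp s" by simp
    then have "1 - exp s \<le> - s" by linarith
    moreover have "exp s < 1" using 2 by simp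
    ultimately have "1 \<le> (- s) / (1 - exp s)" by (subst le_divide_eq_1_pos) auto
    also have "\<dots> = s / (exp s - 1)" by (metis minus_diff_eq minus_divide_divide)
    finally show ?thesis using 2 by (simp add: bernoulli_fun_def)
  next
    case 3
    have "exp s \<le> 1 + s + s\<^sup>2" using exp_bound[of s] 3 assms by simp
    also have "\<dots> \<le> 1 + 2 * s" using 3 assms by (simp add: power2_eq_square mult_left_le)
    finally show ?thesis using 3 by (simp add: bernoulli_fun_def field_simps)
  qed (simp add: bernoulli_fun_def)
qed

lemma abs_diff_exp_le:
  fixes y :: real
  assumes "\<bar>y\<bar> \<le> 1"
  shows "\<bar>1 - exp (- y / 2)\<bar> \<le> \<bar>y\<bar>"
proof (cases "y \<ge> 0")
  case True
  then show ?thesis using exp_ge_add_one_self[of "- y / 2"] by (simp add: abs_if)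
next
  case False
  then have "exp (- y / 2) \<le> 1 + (- y / 2) + (- y / 2)\<^sup>2" using exp_bound[of "- y / 2"] assms by simp
  also have "(- y / 2)\<^sup>2 \<le> - y / 2" using False assms
    by (simp add: power2_eq_square mult_left_le[of "-y/2" "-y/2", simplified])
  finally show ?thesis using False by (simp add: abs_if)
qed

text \<open>For \<open>p \<le> q\<close> the bound \<open>ln x \<le> x - 1\<close> at
  \<open>x = p / q\<close> gives \<open>ln (q / p) \<ge> (q - p) / q\<close>, and the factor
  \<open>q + p\<close> of the difference of squares is at least \<open>q\<close>. The other case is
  symmetric.\<close>

lemma two_sq_diff_le_ln:
  fixes p q :: real
  assumes "p > 0" "q > 0"
  shows "2 * (p - q)\<^sup>2 \<le> (p\<^sup>2 - q\<^sup>2) * (2 * ln (p / q))"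
proof -
  have *: "2 * (q - p)\<^sup>2 \<le> (q\<^sup>2 - p\<^sup>2) * (2 * ln (q / p))" if "0 < p" "p \<le> q" for p q :: real
  proof -
    have "ln (p / q) \<le> p / q - 1" using that by (intro ln_le_minus_one) simp
    then have ln: "(q - p) / q \<le> ln (q / p)" using that by (simp add: ln_div field_simps)
    have "2 * (q - p)\<^sup>2 \<le> 2 * (q - p)\<^sup>2 * ((q + p) / q)"
      using that by (simp add: le_divide_eq mult_left_mono)
    also have "\<dots> = (q\<^sup>2 - p\<^sup>2) * (2 * ((q - p) / q))"
      by (simp add: power2_eq_square algebra_simps add_divide_distrib diff_divide_distrib)
    also have "\<dots> \<le> (q\<^sup>2 - p\<^sup>2) * (2 * ln (q / p))"
      using that ln by (intro mult_left_mono) (auto simp: power_mono)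
    finally show ?thesis .
  qed
  show ?thesis
  proof (cases "p \<le> q")
    case True
    with *[of p q] assms show ?thesis
      by (simp add: power2_commute[of p] ln_div algebra_simps)
  next
    case False
    with *[of q p] assms show ?thesis by simp
  qed
qed

text \<open>After absorbing the potential into \<open>c = a exp (- y / 2)\<close>, the production is that of a pure diffusion.\<close>

lemma sg_production_eq:
  fixes a b y :: real
  assumes "a > 0" "b > 0"
  defines "c \<equiv> a * exp (- y / 2)"
  shows "(bernoulli_fun (- y) * b\<^sup>2 - bernoulli_fun y * a\<^sup>2) * (ln (b\<^sup>2) - ln (a\<^sup>2) + y)
    = bernoulli_fun (- y) * ((b\<^sup>2 - c\<^sup>2) * (2 * ln (b / c)))"
proof -
  have "c\<^sup>2 = exp (- y) * a\<^sup>2"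
    by (simp add: c_def power_mult_distrib power2_eq_square flip: exp_add)
  then have "bernoulli_fun (- y) * b\<^sup>2 - bernoulli_fun y * a\<^sup>2 = bernoulli_fun (- y) * (b\<^sup>2 - c\<^sup>2)"
    by (subst (2) bernoulli_fun_uminus) (simp add: algebra_simps)
  moreover have "ln (b\<^sup>2) - ln (a\<^sup>2) + y = 2 * ln (b / c)"
    using assms by (simp add: c_def ln_div ln_mult ln_realpow)
  ultimately show ?thesis by (simp add: mult.assoc)
qed

text \<open>The sign allows the production to be multiplied by a constant at least 1 in the final
  estimate.\<close>

lemma sg_production_nonneg:
  fixes a b y :: real
  assumes "a > 0" "b > 0"
  shows "0 \<le> (bernoulli_fun (- y) * b\<^sup>2 - bernoulli_fun y * a\<^sup>2) * (ln (b\<^sup>2) - ln (a\<^sup>2) + y)"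
proof -
  have "0 \<le> 2 * (b - a * exp (- y / 2))\<^sup>2" by simp
  also have "\<dots> \<le> (b\<^sup>2 - (a * exp (- y / 2))\<^sup>2) * (2 * ln (b / (a * exp (- y / 2))))"
    using assms by (intro two_sq_diff_le_ln) auto
  finally show ?thesis
    unfolding sg_production_eq[OF assms] using bernoulli_fun_pos[of "- y"] by simp
qed

lemma sg_production_estimate:
  fixes a b y \<delta> :: real
  assumes a: "a > 0" and b: "b > 0" and \<delta>: "\<delta> \<ge> 0"
  shows "\<delta> * \<bar>b - a\<bar> \<le>
    (bernoulli_fun (- y) * b\<^sup>2 - bernoulli_fun y * a\<^sup>2) * (ln (b\<^sup>2) - ln (a\<^sup>2) + y)
      + y\<^sup>2 + \<delta>\<^sup>2 * (1 + ((a + b) / 2)\<^sup>2)"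
proof -
  define Q where "Q = (bernoulli_fun (- y) * b\<^sup>2 - bernoulli_fun y * a\<^sup>2) * (ln (b\<^sup>2) - ln (a\<^sup>2) + y)"
  define c where "c = a * exp (- y / 2)"
  define s where "s = (a + b) / 2"
  have "c > 0" using a by (simp add: c_def)
  have Q_ge: "bernoulli_fun (- y) * (2 * (b - c)\<^sup>2) \<le> Q"
    unfolding Q_def sg_production_eq[OF a b, of y, folded c_def]
    using two_sq_diff_le_ln[OF b \<open>c > 0\<close>] bernoulli_fun_pos[of "- y"] by (intro mult_left_mono) auto
  \<comment> \<open>\<open>s\<^sup>2\<close> is the mean density on the edge.\<close>
  have young: "2 * (\<delta> * s * \<bar>y\<bar>) \<le> \<delta>\<^sup>2 * s\<^sup>2 + y\<^sup>2"
    using sum_squares_bound[of "\<delta> * s" "\<bar>y\<bar>"] by (simp add: power_mult_distrib mult.assoc)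
  have "\<delta> * \<bar>b - a\<bar> \<le> Q + y\<^sup>2 + \<delta>\<^sup>2 * (1 + s\<^sup>2)"
  proof (cases "\<bar>y\<bar> \<le> 1")
    case True
    have "1 / 2 * (2 * (b - c)\<^sup>2) \<le> bernoulli_fun (- y) * (2 * (b - c)\<^sup>2)"
      using True by (intro mult_right_mono bernoulli_fun_ge_half) auto
    with Q_ge have Q: "(b - c)\<^sup>2 \<le> Q" by simp
    have "\<bar>b - a\<bar> \<le> \<bar>b - c\<bar> + a * \<bar>1 - exp (- y / 2)\<bar>"
    proof -
      have "c - a = - (a * (1 - exp (- y / 2)))" by (simp add: c_def algebra_simps)
      then have "\<bar>c - a\<bar> = a * \<bar>1 - exp (- y / 2)\<bar>" using a by (simp add: abs_mult)
      then show ?thesis by linarith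
    qed
    \<comment> \<open>Here \<open>a \<le> a + b = 2 * s\<close>.\<close>
    also have "\<dots> \<le> \<bar>b - c\<bar> + 2 * s * \<bar>y\<bar>"
      using a b abs_diff_exp_le[OF True] by (intro add_left_mono mult_mono) (auto simp: s_def)
    finally have "\<delta> * \<bar>b - a\<bar> \<le> \<delta> * (\<bar>b - c\<bar> + 2 * s * \<bar>y\<bar>)"
      using \<delta> by (rule mult_left_mono)
    \<comment> \<open>This term accounts for the 1 in \<open>1 + s\<^sup>2\<close>.\<close>
    moreover have "\<delta> * \<bar>b - c\<bar> \<le> \<delta>\<^sup>2 + (b - c)\<^sup>2"
      using sum_squares_bound[of \<delta> "\<bar>b - c\<bar>"] zero_le_power2[of \<delta>] zero_le_power2[of "b - c"]
      unfolding power2_abs by linarith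
    ultimately show ?thesis
      using Q young by (simp add: algebra_simps)
  next
    case False
    \<comment> \<open>The trivial bound by the sum of the roots suffices; the factor
      \<open>\<bar>y\<bar> > 1\<close> gives it the form required by Young's inequality.\<close>
    have "\<bar>b - a\<bar> \<le> 2 * s" using a b by (simp add: s_def abs_if field_simps)
    also have "\<dots> \<le> 2 * s * \<bar>y\<bar>" using False a b mult_left_mono[of 1 "\<bar>y\<bar>" "2 * s"] by (simp add: s_def)
    finally have "\<delta> * \<bar>b - a\<bar> \<le> \<delta> * (2 * s * \<bar>y\<bar>)" using \<delta> by (rule mult_left_mono)
    moreover have "0 \<le> bernoulli_fun (- y) * (2 * (b - c)\<^sup>2)"
      using bernoulli_fun_pos[of "- y"] by simp
    ultimately show ?thesis
      using Q_ge young zero_le_power2[of \<delta>] unfolding distrib_left by linarith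
  qed
  then show ?thesis by (simp add: Q_def s_def)
qed

subsection \<open>Edges and dual cells\<close>

text \<open>The frontier of a convex set is negligible. Thus the open dual cell may be replaced by a
  closed convex set, whose slices are measurable.\<close>

lemma measure_interior_convex:
  fixes C :: "'a::euclidean_space set"
  assumes "convex C" "bounded C"
  shows "measure lebesgue (interior C) = measure lborel (closure C)"
proof -
  have "negligible (frontier C)" using assms(1) by (rule negligible_convex_frontier)
  moreover have "interior C - closure C = {}"
    using interior_subset closure_subset by blast
  ultimately have "measure lebesgue (closure C) = measure lebesgue (interior C)"
    using assms by (intro measure_negligible_symdiff) (auto simp: frontier_def lmeasurable_interior)
  then show ?thesis by (simp add: measure_completion)
qed

text \<open>The part \<open>v\<close> of \<open>w\<close> orthogonal to \<open>n\<close> has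
  constant inner product with the points of \<open>S\<close>. Were it nonzero, \<open>S\<close>
  would lie in a hyperplane normal to \<open>v\<close> and have measure 0.\<close>

lemma (in unit_normal_frame) parallel_normal:
  assumes sub: "S \<subseteq> {p + v |v. v \<in> span B}" and pos: "measure (completion P) (slice S 0) > 0"
    and orth: "\<And>y z. y \<in> S \<Longrightarrow> z \<in> S \<Longrightarrow> orthogonal w (z - y)"
  shows "norm w = \<bar>w \<bullet> n\<bar>"
proof -
  define v where "v = w - (w \<bullet> n) *\<^sub>R n"
  have "S \<noteq> {}" using pos by (auto simp: slice_def)
  then obtain y where y: "y \<in> S" by blast
  have "v \<bullet> z = v \<bullet> y" if z: "z \<in> S" for z
  proof -
    obtain u u' where "z = p + u" "u \<in> span B" "y = p + u'" "u' \<in> span B"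
      using subsetD[OF sub y] subsetD[OF sub z] by auto
    then have "z - y \<in> span B" by (simp add: span_diff)
    then have "n \<bullet> (z - y) = 0" by (rule normal_span)
    moreover have "w \<bullet> (z - y) = 0" using orth[OF y z] by (simp add: orthogonal_def)
    ultimately have "v \<bullet> (z - y) = 0" by (simp add: v_def inner_diff_left)
    then show ?thesis by (simp add: inner_diff_right)
  qed
  moreover have "v \<bullet> n = 0"
    using norm_n by (simp add: v_def inner_diff_left dot_square_norm)
  ultimately have "v = 0"
    using pos measure_slice_eq_0[of v S "v \<bullet> y"] by auto
  then have "w = (w \<bullet> n) *\<^sub>R n" by (simp add: v_def)
  then show ?thesis using norm_n by (metis norm_scaleR mult.right_neutral)
qed

lemma admissible_meshD:
  assumes "admissible_mesh \<Omega> M"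
  shows "bounded \<Omega>"
    and "\<forall>\<sigma>\<in>edges M. \<sigma> \<subseteq> closure \<Omega> \<and> (\<exists>a b. a \<noteq> 0 \<and> \<sigma> \<subseteq> {x. a \<bullet> x = b}) \<and> face_measure \<sigma> > 0"
    and "edges M = (\<Union>K\<in>cells M. edges_of M K)"
    and "\<forall>K\<in>cells M. \<forall>\<sigma>\<in>edges_of M K. (\<exists>L. common_edge M K L \<sigma>) \<or> \<sigma> \<subseteq> frontier \<Omega>"
    and "\<forall>K L \<sigma>. common_edge M K L \<sigma> \<longrightarrow>
        cell_point M K \<noteq> cell_point M L \<and>
        (\<forall>y\<in>\<sigma>. \<forall>z\<in>\<sigma>. orthogonal (cell_point M L - cell_point M K) (z - y))"
    and "\<forall>K\<in>cells M. \<forall>\<sigma>\<in>edges_of M K. \<sigma> \<subseteq> frontier \<Omega> \<longrightarrow>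
        cell_point M K \<notin> \<sigma> \<and>
        (\<exists>y\<in>\<sigma>. \<forall>z\<in>\<sigma>. orthogonal (cell_point M K - y) (z - y))"
  by (insert assms, unfold admissible_mesh_def) (elim conjE, assumption)+

text \<open>The true constant is \<open>d\<close>; a crude one avoids integrating over the whole cone.\<close>

lemma face_measure_edge_dist_le:
  fixes M :: "'a::euclidean_space fv_mesh"
  assumes adm: "admissible_mesh \<Omega> M" and K: "K \<in> cells M" and \<sigma>: "\<sigma> \<in> edges_of M K"
  shows "edge_dist M K \<sigma> > 0"
    "face_measure \<sigma> * edge_dist M K \<sigma> \<le> 2 ^ (DIM('a) + 1) * measure lebesgue (dual_cell M K \<sigma>)"
proof -
  have "\<sigma> \<in> edges M" using admissible_meshD(3)[OF adm] K \<sigma> by blast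
  with admissible_meshD(2)[OF adm] obtain a b where ab: "a \<noteq> 0" "\<sigma> \<subseteq> {x. a \<bullet> x = b}"
      and pos: "face_measure \<sigma> > 0" and "\<sigma> \<subseteq> closure \<Omega>"
    by meson
  then have bounded: "bounded \<sigma>"
    using admissible_meshD(1)[OF adm] by (meson bounded_closure bounded_subset)
  obtain B p n where frame: "unit_normal_frame B n" and sub: "\<sigma> \<subseteq> {p + v |v. v \<in> span B}"
    and face: "face_measure \<sigma> = measure (completion (Pi\<^sub>M B (\<lambda>_. lborel))) (unit_normal_frame.slice B p n \<sigma> 0)"
    by (rule face_measure_frame[OF ab])
  interpret unit_normal_frame B p n by fact
  have height: "\<bar>(x - p) \<bullet> n\<bar> * face_measure \<sigma> \<le> 2 ^ DIM('a) * measure lebesgue (interior C)"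
    if C: "convex C" "bounded C" "\<sigma> \<subseteq> C" "x \<in> C" for C x
    using C closure_subset[of C]
    by (subst face, subst measure_interior_convex[OF C(1,2)], intro measure_cone_ge) (auto simp: convex_closure)
  have "edge_dist M K \<sigma> > 0 \<and>
    face_measure \<sigma> * edge_dist M K \<sigma> \<le> 2 ^ (DIM('a) + 1) * measure lebesgue (dual_cell M K \<sigma>)"
  proof (cases "interior_edge M K \<sigma>")
    case True
    define L where "L = neighbour M K \<sigma>"
    have "common_edge M K L \<sigma>"
      using True someI_ex unfolding L_def neighbour_def interior_edge_def by metis
    define xK where "xK = cell_point M K"
    define xL where "xL = cell_point M L"
    have ne: "xK \<noteq> xL" and orth: "\<And>y z. y \<in> \<sigma> \<Longrightarrow> z \<in> \<sigma> \<Longrightarrow> orthogonal (xL - xK) (z - y)"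
      using admissible_meshD(5)[OF adm] \<open>common_edge M K L \<sigma>\<close> unfolding xK_def xL_def by blast+
    define C where "C = convex hull (\<sigma> \<union> {xK, xL})"
    have C: "convex C" "bounded C" "\<sigma> \<subseteq> C" "xK \<in> C" "xL \<in> C"
      using bounded by (auto simp: C_def bounded_convex_hull intro: hull_inc)
    have "norm (xL - xK) = \<bar>(xL - xK) \<bullet> n\<bar>"
      by (rule parallel_normal[OF sub _ orth]) (use pos face in auto)
    also have "\<dots> \<le> \<bar>(xK - p) \<bullet> n\<bar> + \<bar>(xL - p) \<bullet> n\<bar>"
      by (simp add: inner_diff_left)
    finally have "norm (xL - xK) * face_measure \<sigma> \<le> (\<bar>(xK - p) \<bullet> n\<bar> + \<bar>(xL - p) \<bullet> n\<bar>) * face_measure \<sigma>"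
      using pos by (intro mult_right_mono) auto
    \<comment> \<open>The cones from both cell points lie in \<open>C\<close>; bounding each by all
      of \<open>C\<close> costs the factor 2.\<close>
    also have "\<dots> \<le> 2 * (2 ^ DIM('a) * measure lebesgue (interior C))"
      using height[OF C(1-3,4)] height[OF C(1-3,5)] by (simp add: algebra_simps)
    finally have "face_measure \<sigma> * norm (xL - xK) \<le> 2 ^ (DIM('a) + 1) * measure lebesgue (interior C)"
      by (simp add: mult.commute)
    moreover have "edge_dist M K \<sigma> = norm (xL - xK)"
      using True by (simp add: edge_dist_def L_def xK_def xL_def dist_norm norm_minus_commute)
    moreover have "dual_cell M K \<sigma> = interior C"
      using True by (simp add: dual_cell_def C_def L_def xK_def xL_def)
    ultimately show ?thesis using ne by simp
  next
    case False
    define x where "x = cell_point M K"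
    have "\<sigma> \<subseteq> frontier \<Omega>"
      using admissible_meshD(4)[OF adm] K \<sigma> False unfolding interior_edge_def by blast
    then have "x \<notin> \<sigma>" "\<exists>y\<in>\<sigma>. \<forall>z\<in>\<sigma>. orthogonal (x - y) (z - y)"
      using admissible_meshD(6)[OF adm] K \<sigma> unfolding x_def by blast+
    then obtain y where y: "y \<in> \<sigma>" "\<And>z. z \<in> \<sigma> \<Longrightarrow> orthogonal (x - y) (z - y)" by blast
    define C where "C = convex hull (\<sigma> \<union> {x})"
    have C: "convex C" "bounded C" "\<sigma> \<subseteq> C" "x \<in> C"
      using bounded by (auto simp: C_def bounded_convex_hull intro: hull_inc)
    \<comment> \<open>Orthogonality to differences from the foot \<open>y\<close> extends to all
      differences within the edge.\<close>
    have "orthogonal (x - y) (z' - z)" if "z \<in> \<sigma>" "z' \<in> \<sigma>" for z z'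
      using y(2)[OF that(1)] y(2)[OF that(2)] by (simp add: orthogonal_def inner_diff_right)
    then have "norm (x - y) = \<bar>(x - y) \<bullet> n\<bar>"
      by (intro parallel_normal[OF sub]) (use pos face in auto)
    \<comment> \<open>The edge lies at height 0, so \<open>y\<close> may be exchanged for
      \<open>p\<close>.\<close>
    moreover have "(y - p) \<bullet> n = 0"
      using subsetD[OF sub y(1)] by (auto simp: inner_commute[of _ n] normal_span)
    ultimately have "norm (x - y) = \<bar>(x - p) \<bullet> n\<bar>"
      by (simp add: inner_diff_left)
    then have "face_measure \<sigma> * norm (x - y) \<le> 2 ^ DIM('a) * measure lebesgue (interior C)"
      using height[OF C] by (simp add: mult.commute)
    also have "\<dots> \<le> 2 ^ (DIM('a) + 1) * measure lebesgue (interior C)"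
      by simp
    finally have "face_measure \<sigma> * norm (x - y) \<le> 2 ^ (DIM('a) + 1) * measure lebesgue (interior C)" .
    \<comment> \<open>By Pythagoras the distance from \<open>x\<close> to the edge is attained at
      \<open>y\<close>.\<close>
    moreover have "infdist x \<sigma> = norm (x - y)"
    proof (rule antisym)
      show "infdist x \<sigma> \<le> norm (x - y)" using infdist_le[OF y(1), of x] by (simp add: dist_norm)
      have "norm (x - y) \<le> dist x z" if "z \<in> \<sigma>" for z
      proof -
        have "(norm (x - z))\<^sup>2 = (norm (x - y))\<^sup>2 + (norm (z - y))\<^sup>2"
          using norm_add_Pythagorean[of "x - y" "y - z"] y(2)[OF that]
          by (simp add: orthogonal_def inner_diff_right norm_minus_commute[of z])
        then show ?thesis by (simp add: dist_norm power2_le_imp_le)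
      qed
      then show "norm (x - y) \<le> infdist x \<sigma>"
        unfolding infdist_def using y(1) by (auto intro: cINF_greatest)
    qed
    moreover have "norm (x - y) > 0" using \<open>x \<notin> \<sigma>\<close> y(1) by auto
    ultimately show ?thesis
      using False by (simp add: edge_dist_def dual_cell_def C_def x_def)
  qed
  then show "edge_dist M K \<sigma> > 0"
    "face_measure \<sigma> * edge_dist M K \<sigma> \<le> 2 ^ (DIM('a) + 1) * measure lebesgue (dual_cell M K \<sigma>)"
    by auto
qed

theorem proposition9:
  "\<exists>C>0. \<forall>(\<Omega> :: 'a::euclidean_space set) (M :: 'a fv_mesh) (u :: 'a discrete_fun) (\<phi> :: 'a discrete_fun).
     admissible_mesh \<Omega> M \<longrightarrow> positive_density M u \<longrightarrow>
     (\<forall>K\<in>cells M. \<forall>\<sigma>\<in>edges_of M K.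
        face_measure \<sigma> * \<bar>edge_diff M sqrt u K \<sigma>\<bar> \<le>
        C * (edge_production M u \<phi> K \<sigma>
             + transmissibility M K \<sigma> * \<bar>edge_diff M (\<lambda>s. s) \<phi> K \<sigma>\<bar>\<^sup>2
             + measure lebesgue (dual_cell M K \<sigma>) * (1 + edge_mean M u K \<sigma>)))"
proof (intro exI[of _ "2 ^ (DIM('a) + 1)"] conjI allI impI ballI)
  fix \<Omega> :: "'a set" and M :: "'a fv_mesh" and u \<phi> :: "'a discrete_fun" and K \<sigma>
  assume adm: "admissible_mesh \<Omega> M" and u: "positive_density M u"
    and K: "K \<in> cells M" and \<sigma>: "\<sigma> \<in> edges_of M K"
  define m where "m = face_measure \<sigma>"
  define \<delta> where "\<delta> = edge_dist M K \<sigma>"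
  define \<Delta> where "\<Delta> = measure lebesgue (dual_cell M K \<sigma>)"
  define y where "y = edge_diff M (\<lambda>s. s) \<phi> K \<sigma>"
  define a where "a = sqrt (cell_val u K)"
  define b where "b = sqrt (outer_val M u K \<sigma>)"
  define Q where "Q = (bernoulli_fun (- y) * b\<^sup>2 - bernoulli_fun y * a\<^sup>2) * (ln (b\<^sup>2) - ln (a\<^sup>2) + y)"
  define s where "s = (a + b) / 2"
  have val: "cell_val u K > 0" "outer_val M u K \<sigma> > 0"
    using u K \<sigma> by (auto simp: positive_density_def)
  then have ab: "a > 0" "b > 0" "a\<^sup>2 = cell_val u K" "b\<^sup>2 = outer_val M u K \<sigma>"
    by (auto simp: a_def b_def)
  have "m > 0"
    using admissible_meshD(2,3)[OF adm] K \<sigma> unfolding m_def by blast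
  have "\<delta> > 0" and vol: "m * \<delta> \<le> 2 ^ (DIM('a) + 1) * \<Delta>"
    using face_measure_edge_dist_le[OF adm K \<sigma>] by (simp_all add: m_def \<delta>_def \<Delta>_def)
  have est: "\<delta> * \<bar>b - a\<bar> \<le> Q + y\<^sup>2 + \<delta>\<^sup>2 * (1 + s\<^sup>2)"
    unfolding Q_def s_def using ab \<open>\<delta> > 0\<close> by (intro sg_production_estimate) auto
  have Q_nonneg: "Q \<ge> 0"
    unfolding Q_def using ab by (intro sg_production_nonneg)
  \<comment> \<open>The factor \<open>m / \<delta>\<close> is the transmissibility.\<close>
  have "m * \<bar>b - a\<bar> = m / \<delta> * (\<delta> * \<bar>b - a\<bar>)"
    using \<open>\<delta> > 0\<close> by simp
  also have "\<dots> \<le> m / \<delta> * (Q + y\<^sup>2 + \<delta>\<^sup>2 * (1 + s\<^sup>2))"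
    using est \<open>m > 0\<close> \<open>\<delta> > 0\<close> by (intro mult_left_mono) auto
  also have "\<dots> = m / \<delta> * (Q + y\<^sup>2) + m * \<delta> * (1 + s\<^sup>2)"
    using \<open>\<delta> > 0\<close> by (simp add: field_simps power2_eq_square)
  \<comment> \<open>The last term uses the volume bound; the other one is nonnegative and is only
    enlarged by the constant.\<close>
  also have "\<dots> \<le> 2 ^ (DIM('a) + 1) * (m / \<delta> * (Q + y\<^sup>2)) + 2 ^ (DIM('a) + 1) * \<Delta> * (1 + s\<^sup>2)"
  proof (intro add_mono mult_right_mono vol)
    have "1 * (m / \<delta> * (Q + y\<^sup>2)) \<le> 2 ^ (DIM('a) + 1) * (m / \<delta> * (Q + y\<^sup>2))"
      using \<open>m > 0\<close> \<open>\<delta> > 0\<close> Q_nonneg by (intro mult_right_mono one_le_power) auto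
    then show "m / \<delta> * (Q + y\<^sup>2) \<le> 2 ^ (DIM('a) + 1) * (m / \<delta> * (Q + y\<^sup>2))" by simp
  qed simp
  also have "\<dots> = 2 ^ (DIM('a) + 1) * (m / \<delta> * Q + m / \<delta> * y\<^sup>2 + \<Delta> * (1 + s\<^sup>2))"
    by (simp add: algebra_simps)
  finally show "face_measure \<sigma> * \<bar>edge_diff M sqrt u K \<sigma>\<bar> \<le>
        2 ^ (DIM('a) + 1) * (edge_production M u \<phi> K \<sigma>
             + transmissibility M K \<sigma> * \<bar>edge_diff M (\<lambda>s. s) \<phi> K \<sigma>\<bar>\<^sup>2
             + measure lebesgue (dual_cell M K \<sigma>) * (1 + edge_mean M u K \<sigma>))"
    using ab(3,4)
    by (simp add: edge_production_def sg_flux_def transmissibility_def edge_mean_def edge_diff_def[of M sqrt]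
        edge_diff_def[of M ln] m_def \<delta>_def \<Delta>_def Q_def s_def y_def a_def b_def mult.assoc)
qed simp

end
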